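(* Let $w_{\rm init}\in\Delta_m^\circ$, let $\pi_{\rm init}\in\Delta_n^m$ have positive components, let $v_{\rm init}>0$, and let $\sigma_{\rm init}=\phi(\pi_{\rm init},w_{\rm init})$. Consider two iterations, one for $(\sigma,\mu)$ started at $(\sigma_{\rm init},v_{\rm init}\sigma_{\rm init})$ and one for $(\pi,\tau)$ started at $(\pi_{\rm init},v_{\rm init}\,w_{\rm init}\odot\pi_{\rm init})$, in which at each step one of the following three kinds of updates is performed simultaneously (with the same parameters) on both: (i) $\mu'=(1-\eta)\mu$ and $\tau'=(1-\eta)\tau$, with $\sigma,\pi$ unchanged; (ii) $\hat\mu=\mu+\beta\sigma$ and $\hat\tau=\tau+\beta\,\mathrm{norm}([\mathbf 1^\top\tau_i])\odot\pi$, with $\sigma,\pi$ unchanged; (iii) $\sigma'_i=\phi^{-1}_{w,i}(\sigma)\,\mathrm{softmax}\big(\ln\phi^{-1}_{\pi,i}(\sigma)+\overline{d\theta}_i\big)$ and $\pi'_i=\mathrm{softmax}\big(\ln\pi_i+\widetilde{d\theta}_i\big)$ for every $i$, with $\mu,\tau$ unchanged, where either $\overline{d\theta}$ and $\widetilde{d\theta}$ solve respectively the differential equations of $\bar G(\sigma,\mu)=0$ and $G(\pi,\tau)=0$, or they solve respectively the Newton equations of $\bar G(\sigma,\mu)=0$ and $G(\pi,\tau)=0$ (these equations are given in the context). Then $(\sigma,\mu)=\Phi(\pi,\tau)$ and $w_{\rm init}=\phi^{-1}_w(\sigma)=\mathrm{norm}([\mathbf 1^\top\mu_i])$ hold at every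 stage of the iteration.
   Context: Let $m,n$ be positive integers. $\Delta_n$ is the unit simplex in $\mathbb{R}^n$; $\Delta_n^m$ is the product of $m$ copies, with elements $\pi=(\pi_1,\dots,\pi_m)\in\mathbb{R}^{m\times n}$; $\Delta_m^\circ=\{w\in\mathbb{R}^m:w_i>0,\ \sum_iw_i=1\}$. $\Delta_{mn}$ is the unit simplex in $\mathbb{R}^{mn}$; vectors of $\mathbb{R}^{mn}$ are written in $m$ blocks of length $n$; $\Delta_{mn}^+=\{\sigma\in\Delta_{mn}:\mathbf 1^\top\sigma_i>0\ \forall i\}$. $\mathrm{reshape}$ identifies $\mathbb{R}^{m\times n}$ with $\mathbb{R}^{mn}$ (rows to blocks). $\mathbf 1$ is the all-one vector of the appropriate dimension; $I$ an identity matrix. For vectors, $\circ$ and $/$ are componentwise; for a matrix $A$ and vector $b$, $A\circ b=A\,\mathrm{diag}(b)$ and $b\circ A=\mathrm{diag}(b)A$ (so $b\circ I=\mathrm{diag}(b)$). $[x_i]$ stacks the $x_i$; $\mathrm{Diag}[x_iI]$ is block diagonal with $n\times n$ blocks $x_iI$; $\mathrm{norm}([x_i])=[x_i]/\sum_jx_j$; $(w\odot\pi)_i=w_i\pi_i$; $\mathrm{softmax}(x)=\exp(x)/(\mathbf 1^\top\exp(x))$; $\ln$ is componentwise; $\delta_{ij}$ is the Kronecker delta. $\phi:\Delta_n^m\times\Delta_m^\circ\to\Delta_{mn}^+$, $\phi(\pi,w)=\sigma$ with $\sigma_i=w_i\pi_i$; $\phi^{-1}(\sigma)=(\phi^{-1}_\pi(\sigma),\phi^{-1}_w(\sigma))$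 with $\phi^{-1}_{w,i}(\sigma)=\mathbf 1^\top\sigma_i$, $\phi^{-1}_{\pi,i}(\sigma)=\sigma_i/(\mathbf 1^\top\sigma_i)$. $\Phi(\pi,\tau)=(\sigma,\mu)$ with $\sigma=\phi(\pi,\mathrm{norm}([\mathbf 1^\top\tau_i]))$, $\mu=\mathrm{reshape}(\tau)$. $F=(F_1,\dots,F_m):\Delta_n^m\to\mathbb{R}^{m\times n}$ is real-analytic (derivatives are those of a real-analytic extension to a neighbourhood), and $\bar F_i(\sigma)=\frac1{w_i}(F_i(\pi)-(\pi_i^\top F_i(\pi))\mathbf 1)$ with $(\pi,w)=\phi^{-1}(\sigma)$. Put $$G_i(\pi,\tau)=(I-\pi_i\mathbf 1^\top)(\pi_i\circ F_i(\pi)-\tau_i),\qquad \bar G(\sigma,\mu)=(I-\sigma\mathbf 1^\top)(\sigma\circ\bar F(\sigma)-\mu).$$ With $k\in\mathbb{R}$ an arbitrary scalar and $w=\mathrm{norm}([\mathbf 1^\top\tau_i])$, $$J_{ij}(\pi)=(I-\mathbf 1\pi_i^\top)\Big(\tfrac{\partial F_i(\pi)}{\partial\pi_j}\circ\pi_j+\delta_{ij}\big((I-\mathbf 1\pi_i^\top)F_i(\pi)\big)\circ I\Big)(I-\mathbf 1\pi_j^\top)+kw_iw_j\mathbf 1\pi_j^\top,$$ $$\bar J(\sigma)=(I-\mathbf 1\sigma^\top)\Big(\tfrac{\partial\bar F(\sigma)}{\partial\sigma}\circ\sigma+\big((I-\mathbf 1\sigma^\top)\bar F(\sigma)\big)\circ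 I\Big)(I-\mathbf 1\sigma^\top)+k\mathbf 1\sigma^\top,$$ where $J(\pi)$ is the $mn\times mn$ matrix with blocks $J_{ij}(\pi)$. Differential equations, for increments $d\mu\in\mathbb{R}^{mn}$ and $d\tau\in\mathbb{R}^{m\times n}$: $$(\bar J(\sigma)+(\mathbf 1^\top\mu)I)\,\overline{d\theta}=(I-\mathbf 1\sigma^\top)(d\mu/\sigma),\qquad \big(J(\pi)+\mathrm{Diag}[(\mathbf 1^\top\tau_i)I]\big)\widetilde{d\theta}=\big[(I-\mathbf 1\pi_i^\top)(d\tau_i/\pi_i)\big].$$ In the iteration, $d\mu$ and $d\tau$ are the increments of $\mu$ and $\tau$ produced by an update of kind (i), hence $d\mu=\kappa\mu$, $d\tau=\kappa\tau$ with a common scalar $\kappa\in\mathbb{R}$. Newton equations: $$(\bar J(\sigma)+(\mathbf 1^\top\mu)I)\,\overline{d\theta}=-\bar G(\sigma,\mu)/\sigma,\qquad \big(J(\pi)+\mathrm{Diag}[(\mathbf 1^\top\tau_i)I]\big)\widetilde{d\theta}=-\big[G_i(\pi,\tau)/\pi_i\big].$$ Here $\overline{d\theta},\widetilde{d\theta}\in\mathbb{R}^{mn}$ are of the form $\overline{d\theta}=(I-\mathbf 1\sigma^\top)d\theta$ (so $\sigma^\top\overline{d\theta}=0$) and $\widetilde{d\theta}_i=(I-\mathbf 1\pi_i^\top)d\theta_i$ (so $\pi_i^\top\widetilde{d\theta}_i=0$). Parameters are such that all expressions are defined: $\eta\in(0,1)$; $\beta\in\mathbb{R}$ with $\mathbf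 1^\top\mu+\beta\neq0$; and whenever update (iii) is performed, the coefficient matrices of the equations are nonsingular (singular points being avoided). *)

theory Defs
  imports "HOL-Analysis.Analysis"
begin

text \<open>
  Conventions. \<open>\<real>\<^sup>m\<^sup>\<times>\<^sup>n\<close> is \<open>real^'n^'m\<close>, with rows \<open>x $ i\<close>; \<open>\<real>\<^sup>m\<^sup>n\<close> is \<open>real^('m \<times> 'n)\<close>, the
  component \<open>(i, a)\<close> being the \<open>a\<close>-th entry of the \<open>i\<close>-th block.  On vectors, the library's
  \<open>*\<close> is the componentwise product and \<open>1\<close> is the all-one vector, so \<open>1 \<bullet> x\<close> is the sum of the
  entries of \<open>x\<close>.  The identity matrix is \<open>mat 1\<close> and the matrix product is \<open>**\<close>.
\<close>

section \<open>Vectors, blocks and matrices\<close>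

definition vdiv :: "real^'n \<Rightarrow> real^'n \<Rightarrow> real^'n" (infixl "\<oslash>" 70)
  where "x \<oslash> y = (\<chi> a. x $ a / y $ a)"

definition vln :: "real^'n \<Rightarrow> real^'n"
  where "vln x = (\<chi> a. ln (x $ a))"

definition softmax :: "real^'n \<Rightarrow> real^'n"
  where "softmax x = (\<chi> a. exp (x $ a) / (\<Sum>b\<in>UNIV. exp (x $ b)))"

definition sum_normalize :: "real^'m \<Rightarrow> real^'m"
  where "sum_normalize x = (\<chi> i. x $ i / (\<Sum>j\<in>UNIV. x $ j))"

definition outer :: "real^'p \<Rightarrow> real^'q \<Rightarrow> real^'q^'p"
  where "outer u v = (\<chi> a b. u $ a * v $ b)"

definition diag :: "real^'n \<Rightarrow> real^'n^'n"
  where "diag b = (\<chi> a c. if a = c then b $ a else 0)"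

definition reshape :: "real^'n^'m \<Rightarrow> real^('m \<times> 'n)"
  where "reshape x = (\<chi> p. x $ fst p $ snd p)"

definition block :: "real^('m::finite \<times> 'n::finite) \<Rightarrow> 'm \<Rightarrow> real^'n"
  where "block s i = (\<chi> a. s $ (i, a))"

definition block_matrix :: "('m \<Rightarrow> 'm \<Rightarrow> real^'n^'n) \<Rightarrow> real^('m::finite \<times> 'n::finite)^('m \<times> 'n)"
  where "block_matrix B = (\<chi> p q. B (fst p) (fst q) $ snd p $ snd q)"

definition block_sums :: "real^('m::finite \<times> 'n::finite) \<Rightarrow> real^'m"
  where "block_sums s = (\<chi> i. 1 \<bullet> block s i)"

definition row_sums :: "real^'n^'m \<Rightarrow> real^'m"
  where "row_sums x = (\<chi> i. 1 \<bullet> x $ i)"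

definition odot :: "real^'m \<Rightarrow> real^'n^'m \<Rightarrow> real^'n^'m" (infixl "\<odot>" 75)
  where "w \<odot> x = (\<chi> i. w $ i *\<^sub>R x $ i)"

section \<open>Simplices and the maps between them\<close>

definition unit_simplex :: "(real^'n) set"
  where "unit_simplex = {x. (\<forall>a. 0 \<le> x $ a) \<and> (\<Sum>a\<in>UNIV. x $ a) = 1}"

definition open_simplex :: "(real^'m) set"
  where "open_simplex = {w. (\<forall>i. 0 < w $ i) \<and> (\<Sum>i\<in>UNIV. w $ i) = 1}"

definition simplex_prod :: "(real^'n^'m) set"
  where "simplex_prod = {x. \<forall>i. x $ i \<in> unit_simplex}"

definition phi :: "real^'n^'m \<Rightarrow> real^'m \<Rightarrow> real^('m \<times> 'n)"
  where "phi \<pi> w = reshape (w \<odot> \<pi>)"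

text \<open>The two components of the inverse of \<^const>\<open>phi\<close>.\<close>

definition phi_inv_w :: "real^('m::finite \<times> 'n::finite) \<Rightarrow> real^'m"
  where "phi_inv_w \<sigma> = block_sums \<sigma>"

definition phi_inv_pi :: "real^('m \<times> 'n) \<Rightarrow> real^'n^'m"
  where "phi_inv_pi \<sigma> = (\<chi> i. (1 / (1 \<bullet> block \<sigma> i)) *\<^sub>R block \<sigma> i)"

definition Phi :: "real^'n^'m \<Rightarrow> real^'n^'m \<Rightarrow> (real^('m \<times> 'n)) \<times> (real^('m \<times> 'n))"
  where "Phi \<pi> \<tau> = (phi \<pi> (sum_normalize (row_sums \<tau>)), reshape \<tau>)"

section \<open>Real-analytic maps\<close>

text \<open>
  Around every point of \<open>S\<close> the map is the sum of a multivariate power series; the multi-indices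
  are the functions from the standard basis to \<^typ>\<open>nat\<close>.
\<close>

definition real_analytic_on ::
    "('a::euclidean_space \<Rightarrow> 'b::real_normed_vector) \<Rightarrow> 'a set \<Rightarrow> bool"
  where "real_analytic_on f S \<longleftrightarrow>
    (\<forall>x\<in>S. \<exists>r>0. \<exists>c :: ('a \<Rightarrow> nat) \<Rightarrow> 'b. \<forall>y\<in>ball x r.
      ((\<lambda>\<alpha>. (\<Prod>b\<in>Basis. ((y - x) \<bullet> b) ^ \<alpha> b) *\<^sub>R c \<alpha>) has_sum f y) (Basis \<rightarrow>\<^sub>E UNIV))"

section \<open>The equations\<close>

text \<open>
  The formula for \<open>Fbar\<close> is used on all of \<open>\<real>\<^sup>m\<^sup>n\<close>.  When \<open>F\<close> is real-analytic on a neighbourhood of the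
  product of simplices, it defines a real-analytic extension of the original map to a neighbourhood
  of the set of \<open>\<sigma>\<close> in the unit simplex all of whose block sums are positive; derivatives of \<open>Fbar\<close>
  are those of this extension.
\<close>

definition Fbar :: "(real^'n^'m \<Rightarrow> real^'n^'m) \<Rightarrow> real^('m \<times> 'n) \<Rightarrow> real^('m \<times> 'n)"
  where "Fbar F \<sigma> = (let w = phi_inv_w \<sigma>; \<pi> = phi_inv_pi \<sigma> in
    reshape (\<chi> i. (1 / w $ i) *\<^sub>R (F \<pi> $ i - (\<pi> $ i \<bullet> F \<pi> $ i) *\<^sub>R 1)))"

definition G :: "(real^'n^'m \<Rightarrow> real^'n^'m) \<Rightarrow> real^'n^'m \<Rightarrow> real^'n^'m \<Rightarrow> real^'n^'m"
  where "G F \<pi> \<tau> = (\<chi> i. (mat 1 - outer (\<pi> $ i) 1) *v (\<pi> $ i * F \<pi> $ i - \<tau> $ i))"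

definition Gbar ::
    "(real^'n^'m \<Rightarrow> real^'n^'m) \<Rightarrow> real^('m \<times> 'n) \<Rightarrow> real^('m \<times> 'n) \<Rightarrow> real^('m \<times> 'n)"
  where "Gbar F \<sigma> \<mu> = (mat 1 - outer \<sigma> 1) *v (\<sigma> * Fbar F \<sigma> - \<mu>)"

definition partial_jacobian ::
    "(real^'n^'m \<Rightarrow> real^'n^'m) \<Rightarrow> real^'n^'m \<Rightarrow> 'm \<Rightarrow> 'm \<Rightarrow> real^'n^'n"
  where "partial_jacobian F \<pi> i j =
    jacobian (\<lambda>p. F (\<chi> l. if l = j then p else \<pi> $ l) $ i) (at (\<pi> $ j))"

definition J_block ::
    "(real^'n^'m \<Rightarrow> real^'n^'m) \<Rightarrow> real \<Rightarrow> real^'n^'m \<Rightarrow> real^'n^'m \<Rightarrow> 'm \<Rightarrow> 'm \<Rightarrow> real^'n^'n"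
  where "J_block F k \<pi> \<tau> i j = (let w = sum_normalize (row_sums \<tau>) in
    (mat 1 - outer 1 (\<pi> $ i)) **
      (partial_jacobian F \<pi> i j ** diag (\<pi> $ j) +
        (if i = j then diag ((mat 1 - outer 1 (\<pi> $ i)) *v (F \<pi> $ i)) else 0)) **
      (mat 1 - outer 1 (\<pi> $ j)) +
    (k * w $ i * w $ j) *\<^sub>R outer 1 (\<pi> $ j))"

definition Jbar ::
    "(real^'n^'m \<Rightarrow> real^'n^'m) \<Rightarrow> real \<Rightarrow> real^('m \<times> 'n) \<Rightarrow> real^('m \<times> 'n)^('m \<times> 'n)"
  where "Jbar F k \<sigma> =
    (mat 1 - outer 1 \<sigma>) **
      (jacobian (Fbar F) (at \<sigma>) ** diag \<sigma> + diag ((mat 1 - outer 1 \<sigma>) *v Fbar F \<sigma>)) **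
      (mat 1 - outer 1 \<sigma>) +
    k *\<^sub>R outer 1 \<sigma>"

text \<open>The coefficient matrices common to the differential equations and the Newton equations.\<close>

definition coeff_sigma ::
    "(real^'n^'m \<Rightarrow> real^'n^'m) \<Rightarrow> real \<Rightarrow> real^('m \<times> 'n) \<Rightarrow> real^('m \<times> 'n)
      \<Rightarrow> real^('m \<times> 'n)^('m \<times> 'n)"
  where "coeff_sigma F k \<sigma> \<mu> = Jbar F k \<sigma> + (1 \<bullet> \<mu>) *\<^sub>R mat 1"

definition coeff_pi ::
    "(real^'n^'m \<Rightarrow> real^'n^'m) \<Rightarrow> real \<Rightarrow> real^'n^'m \<Rightarrow> real^'n^'m
      \<Rightarrow> real^('m \<times> 'n)^('m \<times> 'n)"
  where "coeff_pi F k \<pi> \<tau> =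
    block_matrix (J_block F k \<pi> \<tau>) +
    block_matrix (\<lambda>i j. if i = j then (1 \<bullet> \<tau> $ i) *\<^sub>R mat 1 else 0)"

definition differential_eq_sigma ::
    "(real^'n^'m \<Rightarrow> real^'n^'m) \<Rightarrow> real \<Rightarrow> real^('m \<times> 'n) \<Rightarrow> real^('m \<times> 'n)
      \<Rightarrow> real^('m \<times> 'n) \<Rightarrow> real^('m \<times> 'n) \<Rightarrow> bool"
  where "differential_eq_sigma F k \<sigma> \<mu> d\<mu> d\<theta> \<longleftrightarrow>
    coeff_sigma F k \<sigma> \<mu> *v d\<theta> = (mat 1 - outer 1 \<sigma>) *v (d\<mu> \<oslash> \<sigma>)"

definition differential_eq_pi ::
    "(real^'n^'m \<Rightarrow> real^'n^'m) \<Rightarrow> real \<Rightarrow> real^'n^'m \<Rightarrow> real^'n^'m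
      \<Rightarrow> real^'n^'m \<Rightarrow> real^('m \<times> 'n) \<Rightarrow> bool"
  where "differential_eq_pi F k \<pi> \<tau> d\<tau> d\<theta> \<longleftrightarrow>
    coeff_pi F k \<pi> \<tau> *v d\<theta> =
      reshape (\<chi> i. (mat 1 - outer 1 (\<pi> $ i)) *v (d\<tau> $ i \<oslash> \<pi> $ i))"

definition newton_eq_sigma ::
    "(real^'n^'m \<Rightarrow> real^'n^'m) \<Rightarrow> real \<Rightarrow> real^('m \<times> 'n) \<Rightarrow> real^('m \<times> 'n)
      \<Rightarrow> real^('m \<times> 'n) \<Rightarrow> bool"
  where "newton_eq_sigma F k \<sigma> \<mu> d\<theta> \<longleftrightarrow>
    coeff_sigma F k \<sigma> \<mu> *v d\<theta> = - (Gbar F \<sigma> \<mu> \<oslash> \<sigma>)"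

definition newton_eq_pi ::
    "(real^'n^'m \<Rightarrow> real^'n^'m) \<Rightarrow> real \<Rightarrow> real^'n^'m \<Rightarrow> real^'n^'m
      \<Rightarrow> real^('m \<times> 'n) \<Rightarrow> bool"
  where "newton_eq_pi F k \<pi> \<tau> d\<theta> \<longleftrightarrow>
    coeff_pi F k \<pi> \<tau> *v d\<theta> = - reshape (\<chi> i. G F \<pi> \<tau> $ i \<oslash> \<pi> $ i)"

definition projected_sigma :: "real^('m::finite \<times> 'n::finite) \<Rightarrow> real^('m \<times> 'n) \<Rightarrow> bool"
  where "projected_sigma \<sigma> d\<theta> \<longleftrightarrow> (\<exists>d. d\<theta> = (mat 1 - outer 1 \<sigma>) *v d)"

definition projected_pi :: "real^'n^'m \<Rightarrow> real^('m \<times> 'n) \<Rightarrow> bool"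
  where "projected_pi \<pi> d\<theta> \<longleftrightarrow>
    (\<exists>d. \<forall>i. block d\<theta> i = (mat 1 - outer 1 (\<pi> $ i)) *v block d i)"

section \<open>The two iterations\<close>

definition update_sigma :: "real^('m::finite \<times> 'n::finite) \<Rightarrow> real^('m \<times> 'n) \<Rightarrow> real^('m \<times> 'n)"
  where "update_sigma \<sigma> d\<theta> =
    reshape (\<chi> i. phi_inv_w \<sigma> $ i *\<^sub>R softmax (vln (phi_inv_pi \<sigma> $ i) + block d\<theta> i))"

definition update_pi :: "real^'n^'m \<Rightarrow> real^('m \<times> 'n) \<Rightarrow> real^'n^'m"
  where "update_pi \<pi> d\<theta> = (\<chi> i. softmax (vln (\<pi> $ i) + block d\<theta> i))"

text \<open>
  One simultaneous step of both iterations, on states \<open>(\<sigma>, \<mu>, \<pi>, \<tau>)\<close>.  The scalars \<open>\<eta>\<close>, \<open>\<beta>\<close>, \<open>\<kappa>\<close>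
  may differ from step to step but are shared by the two iterations.
\<close>

inductive joint_step ::
    "(real^'n^'m \<Rightarrow> real^'n^'m) \<Rightarrow> real \<Rightarrow>
      (real^('m \<times> 'n)) \<times> (real^('m \<times> 'n)) \<times> (real^'n^'m) \<times> (real^'n^'m) \<Rightarrow>
      (real^('m \<times> 'n)) \<times> (real^('m \<times> 'n)) \<times> (real^'n^'m) \<times> (real^'n^'m) \<Rightarrow> bool"
  for F k where
  scale: "\<lbrakk>0 < \<eta>; \<eta> < 1\<rbrakk> \<Longrightarrow>
    joint_step F k (\<sigma>, \<mu>, \<pi>, \<tau>) (\<sigma>, (1 - \<eta>) *\<^sub>R \<mu>, \<pi>, (1 - \<eta>) *\<^sub>R \<tau>)"
| shift: "1 \<bullet> \<mu> + \<beta> \<noteq> 0 \<Longrightarrow>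
    joint_step F k (\<sigma>, \<mu>, \<pi>, \<tau>)
      (\<sigma>, \<mu> + \<beta> *\<^sub>R \<sigma>, \<pi>, \<tau> + \<beta> *\<^sub>R (sum_normalize (row_sums \<tau>) \<odot> \<pi>))"
| differential: "\<lbrakk>invertible (coeff_sigma F k \<sigma> \<mu>); invertible (coeff_pi F k \<pi> \<tau>);
    projected_sigma \<sigma> d\<theta>bar; projected_pi \<pi> d\<theta>tilde;
    d\<mu> = \<kappa> *\<^sub>R \<mu>; d\<tau> = \<kappa> *\<^sub>R \<tau>;
    differential_eq_sigma F k \<sigma> \<mu> d\<mu> d\<theta>bar; differential_eq_pi F k \<pi> \<tau> d\<tau> d\<theta>tilde\<rbrakk> \<Longrightarrow>
    joint_step F k (\<sigma>, \<mu>, \<pi>, \<tau>) (update_sigma \<sigma> d\<theta>bar, \<mu>, update_pi \<pi> d\<theta>tilde, \<tau>)"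
| newton: "\<lbrakk>invertible (coeff_sigma F k \<sigma> \<mu>); invertible (coeff_pi F k \<pi> \<tau>);
    projected_sigma \<sigma> d\<theta>bar; projected_pi \<pi> d\<theta>tilde;
    newton_eq_sigma F k \<sigma> \<mu> d\<theta>bar; newton_eq_pi F k \<pi> \<tau> d\<theta>tilde\<rbrakk> \<Longrightarrow>
    joint_step F k (\<sigma>, \<mu>, \<pi>, \<tau>) (update_sigma \<sigma> d\<theta>bar, \<mu>, update_pi \<pi> d\<theta>tilde, \<tau>)"

end

theory Submission
  imports Defs
begin

text \<open>
  The coupling \<open>\<sigma>\<^sub>i = w\<^sub>i \<pi>\<^sub>i\<close>, \<open>\<mu>\<^sub>i = \<tau>\<^sub>i\<close>, \<open>1 \<bullet> \<tau>\<^sub>i = c w\<^sub>i\<close> with \<open>c = 1 \<bullet> \<mu> \<noteq> 0\<close> and a constant \<open>w\<close> is an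
  invariant of the joint iteration.  For updates of kind (iii), let \<open>x\<close> with \<open>\<sigma> \<bullet> x = 0\<close> be the
  increment of the \<open>\<sigma>\<close>-iteration and put \<open>y\<^sub>i = x\<^sub>i - (\<pi>\<^sub>i \<bullet> x\<^sub>i) 1\<close>.  Differentiating \<open>Fbar\<close> along
  \<open>\<sigma> \<circ> x\<close> by the chain rule moves \<open>\<pi>\<close> along \<open>\<pi> \<circ> y\<close>, and the change of the block sums is compensated by
  the diagonal term of \<open>Jbar\<close>, so that \<open>w\<^sub>i (Jbar x)\<^sub>i = (J y)\<^sub>i\<close>.  Centering the \<open>i\<close>-th block of the
  equation for \<open>x\<close> and multiplying it by \<open>w\<^sub>i\<close> therefore gives the equation of the \<open>\<pi>\<close>-iteration for
  \<open>y\<close>.  As that equation is uniquely solvable, the two increments differ in each block by a multiple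
  of \<open>1\<close>, which softmax ignores.
\<close>

section \<open>Real-analytic maps are differentiable\<close>

text \<open>The bound at \<open>y = x\<close> forces \<open>f x = 0\<close>, so the difference
  quotient is squeezed by \<open>C * norm (y - x)\<close>.\<close>

lemma has_derivative_zero_quadratic_bound:
  fixes f :: "'a::real_normed_vector \<Rightarrow> 'b::real_normed_vector"
  assumes "0 < t" and bound: "\<And>y. norm (y - x) \<le> t \<Longrightarrow> norm (f y) \<le> C * (norm (y - x))\<^sup>2"
  shows "(f has_derivative (\<lambda>_. 0)) (at x)"
proof (rule has_derivativeI_sandwich[OF \<open>0 < t\<close>, where H = "\<lambda>y. C * norm (y - x)"])
  have fx: "f x = 0"
    using bound[of x] \<open>0 < t\<close> by simp
  show "norm (f y - f x - 0) / norm (y - x) \<le> C * norm (y - x)"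
    if "y \<noteq> x" "dist y x < t" for y
  proof -
    have "norm (f y) \<le> C * (norm (y - x))\<^sup>2"
      using that bound by (simp add: dist_norm)
    then show ?thesis
      using that fx by (simp add: divide_le_eq power2_eq_square mult.assoc)
  qed
  show "((\<lambda>y. C * norm (y - x)) \<longlongrightarrow> 0) (at x)"
    by (auto intro!: tendsto_eq_intros)
qed simp

text \<open>The terms of total degree at most 1 form a finite sum \<open>p\<close>, which is
  differentiable, and the others sum to a remainder quadratic in \<open>norm (y - x)\<close>. The
  centre suffices, since analyticity provides a series about every point.\<close>

lemma power_series_differentiable_at_center:
  fixes g :: "'a::euclidean_space \<Rightarrow> real" and c :: "('a \<Rightarrow> nat) \<Rightarrow> real"
  assumes "0 < r"
    and series: "\<And>y. y \<in> ball x r \<Longrightarrow>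
      ((\<lambda>\<alpha>. (\<Prod>b\<in>Basis. ((y - x) \<bullet> b) ^ \<alpha> b) * c \<alpha>) has_sum g y) (Basis \<rightarrow>\<^sub>E UNIV)"
  shows "g differentiable (at x)"
proof -
  define A :: "('a \<Rightarrow> nat) set" where "A = Basis \<rightarrow>\<^sub>E UNIV"
  define N :: "('a \<Rightarrow> nat) \<Rightarrow> nat" where "N \<alpha> = (\<Sum>b\<in>Basis. \<alpha> b)" for \<alpha>
  define L where "L = {\<alpha>\<in>A. N \<alpha> \<le> 1}"
  define T where "T y \<alpha> = (\<Prod>b\<in>Basis. ((y - x) \<bullet> b) ^ \<alpha> b) * c \<alpha>" for y \<alpha>
  define p where "p y = (\<Sum>\<alpha>\<in>L. T y \<alpha>)" for y
  \<comment> \<open>As \<open>t * (norm One + 2) = r\<close>, both the diagonal point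
    \<open>x + t *\<^sub>R One\<close> and every \<open>y\<close> with
    \<open>norm (y - x) \<le> t\<close> lie in \<open>ball x r\<close>.\<close>
  define t where "t = r / (norm (One :: 'a) + 2)"
  define S where "S = (\<Sum>\<^sub>\<infinity>\<alpha>\<in>A - L. t ^ N \<alpha> * \<bar>c \<alpha>\<bar>)"
  have "0 < t"
    using \<open>0 < r\<close> by (simp add: t_def add_nonneg_pos)
  have "t * norm (One :: 'a) < t * (norm (One :: 'a) + 2)"
    using \<open>0 < t\<close> by simp
  also have t_mult: "\<dots> = r"
    using norm_ge_zero[of "One :: 'a"] by (simp add: t_def del: norm_ge_zero)
  finally have t_ball: "x + t *\<^sub>R One \<in> ball x r"
    using \<open>0 < t\<close> by (simp add: dist_norm)
  have finL: "finite L"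
  proof (rule finite_subset)
    show "L \<subseteq> Basis \<rightarrow>\<^sub>E {..1}"
    proof
      fix \<alpha> assume \<alpha>: "\<alpha> \<in> L"
      have "\<alpha> b \<le> 1" if "b \<in> Basis" for b
      proof -
        have "\<alpha> b \<le> N \<alpha>"
          unfolding N_def using that by (intro member_le_sum) auto
        also have "\<dots> \<le> 1"
          using \<alpha> by (simp add: L_def)
        finally show ?thesis .
      qed
      moreover have "\<alpha> \<in> extensional Basis"
        using \<alpha> by (simp add: L_def A_def PiE_def)
      ultimately show "\<alpha> \<in> Basis \<rightarrow>\<^sub>E {..1}"
        by (intro PiE_I) (auto dest: extensional_arb)
    qed
  qed (intro finite_PiE; simp)
  \<comment> \<open>Convergence at the diagonal point \<open>x + t *\<^sub>R One\<close> gives a common majorant for the terms of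
    degree at least 2 near \<open>x\<close>.\<close>
  have T_t: "T (x + t *\<^sub>R One) \<alpha> = t ^ N \<alpha> * c \<alpha>" for \<alpha>
    by (simp add: T_def N_def power_sum)
  have "(\<lambda>\<alpha>. T (x + t *\<^sub>R One) \<alpha>) summable_on A"
    unfolding T_def A_def by (rule has_sum_imp_summable[OF series[OF t_ball]])
  then have "(\<lambda>\<alpha>. t ^ N \<alpha> * c \<alpha>) summable_on A"
    by (simp only: T_t)
  then have "(\<lambda>\<alpha>. t ^ N \<alpha> * \<bar>c \<alpha>\<bar>) summable_on A"
    unfolding summable_on_iff_abs_summable_on_real[of "\<lambda>\<alpha>. t ^ N \<alpha> * c \<alpha>"]
    using \<open>0 < t\<close> by (simp add: abs_mult)
  then have major: "(\<lambda>\<alpha>. t ^ N \<alpha> * \<bar>c \<alpha>\<bar>) summable_on A - L"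
    by (rule summable_on_subset_banach) auto
  have remainder: "norm (g y - p y) \<le> S / t\<^sup>2 * (norm (y - x))\<^sup>2" if y: "norm (y - x) \<le> t" for y
  proof -
    define h where "h = y - x"
    have "t < t * (norm (One :: 'a) + 2)"
      using \<open>0 < t\<close> norm_ge_zero[of "One :: 'a"] by (simp del: norm_ge_zero)
    then have "y \<in> ball x r"
      using y t_mult by (simp add: dist_norm norm_minus_commute)
    then have "(T y has_sum g y) A"
      using series unfolding T_def[abs_def] A_def by blast
    then have rest: "(T y has_sum (g y - p y)) (A - L)"
      unfolding p_def by (intro has_sum_Diff has_sum_finite finL) (auto simp: L_def)
    \<comment> \<open>Each monomial is at most \<open>norm h ^ N \<alpha>\<close>; two of these
      factors are kept and the others are bounded by \<open>t\<close>.\<close>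
    have le: "norm (T y \<alpha>) \<le> (norm h / t)\<^sup>2 * (t ^ N \<alpha> * \<bar>c \<alpha>\<bar>)" if "\<alpha> \<in> A - L" for \<alpha>
    proof -
      have "2 \<le> N \<alpha>"
        using that by (auto simp: L_def)
      then obtain q where q: "N \<alpha> = 2 + q"
        by (metis le_Suc_ex)
      have "(\<Prod>b\<in>Basis. \<bar>h \<bullet> b\<bar> ^ \<alpha> b) \<le> (\<Prod>b\<in>Basis. norm h ^ \<alpha> b)"
        by (intro prod_mono) (auto intro!: power_mono Basis_le_norm)
      also have "\<dots> = (norm h)\<^sup>2 * norm h ^ q"
        by (simp add: power_sum[symmetric] N_def[symmetric] q power_add power2_eq_square)
      also have "\<dots> \<le> (norm h)\<^sup>2 * t ^ q"
        using y by (intro mult_left_mono power_mono) (auto simp: h_def)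
      also have "\<dots> = (norm h / t)\<^sup>2 * t ^ N \<alpha>"
        using \<open>0 < t\<close> by (simp add: q power_divide power2_eq_square)
      finally have "(\<Prod>b\<in>Basis. \<bar>h \<bullet> b\<bar> ^ \<alpha> b) * \<bar>c \<alpha>\<bar> \<le> (norm h / t)\<^sup>2 * t ^ N \<alpha> * \<bar>c \<alpha>\<bar>"
        by (rule mult_right_mono) simp
      then show ?thesis
        by (simp add: T_def h_def abs_mult abs_prod power_abs mult.assoc)
    qed
    have bounds: "((\<lambda>\<alpha>. (norm h / t)\<^sup>2 * (t ^ N \<alpha> * \<bar>c \<alpha>\<bar>)) has_sum (norm h / t)\<^sup>2 * S) (A - L)"
      unfolding S_def by (intro has_sum_cmult_right has_sum_infsum major)
    \<comment> \<open>The comparison of sums is one-sided, so it is applied to the remainder and to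
      its negative.\<close>
    have "g y - p y \<le> (norm h / t)\<^sup>2 * S"
      using le by (intro has_sum_mono[OF rest bounds]) (auto simp: abs_le_iff)
    moreover have "- (g y - p y) \<le> (norm h / t)\<^sup>2 * S"
      using le by (intro has_sum_mono[OF has_sum_uminusI[OF rest] bounds]) (auto simp: abs_le_iff)
    ultimately have "norm (g y - p y) \<le> (norm h / t)\<^sup>2 * S"
      by (simp add: abs_le_iff)
    then show ?thesis
      by (simp add: h_def power_divide mult.commute)
  qed
  have "((\<lambda>y. g y - p y) has_derivative (\<lambda>_. 0)) (at x)"
    by (rule has_derivative_zero_quadratic_bound[OF \<open>0 < t\<close> remainder])
  moreover have "p differentiable (at x)"
  proof -
    have monomial: "((\<lambda>y. ((y - x) \<bullet> b) ^ n) has_derivative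
        (\<lambda>h. of_nat n * (h \<bullet> b) * ((x - x) \<bullet> b) ^ (n - 1))) (at x)" for b n
      by (auto intro!: derivative_eq_intros)
    have "(\<lambda>y. \<Prod>b\<in>Basis. ((y - x) \<bullet> b) ^ \<alpha> b) differentiable (at x)" for \<alpha>
      unfolding differentiable_def by (rule exI, rule has_derivative_prod, rule monomial)
    then show ?thesis
      unfolding p_def T_def by (intro differentiable_sum finL ballI differentiable_mult) auto
  qed
  ultimately have "(\<lambda>y. (g y - p y) + p y) differentiable (at x)"
    by (intro differentiable_add) (auto simp: differentiable_def)
  then show ?thesis
    by simp
qed

lemma real_analytic_on_imp_differentiable:
  fixes f :: "'a::euclidean_space \<Rightarrow> 'b::euclidean_space"
  assumes "real_analytic_on f S" "x \<in> S"
  shows "f differentiable (at x)"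
  unfolding differentiable_componentwise_within[of f x UNIV]
proof
  fix i :: 'b assume "i \<in> Basis"
  obtain r c where "0 < r" and c: "\<And>y. y \<in> ball x r \<Longrightarrow>
      ((\<lambda>\<alpha>. (\<Prod>b\<in>Basis. ((y - x) \<bullet> b) ^ \<alpha> b) *\<^sub>R c \<alpha>) has_sum f y) (Basis \<rightarrow>\<^sub>E UNIV)"
    using assms unfolding real_analytic_on_def by blast
  show "(\<lambda>y. f y \<bullet> i) differentiable (at x)"
  proof (rule power_series_differentiable_at_center[OF \<open>0 < r\<close>, where c = "\<lambda>\<alpha>. c \<alpha> \<bullet> i"])
    show "((\<lambda>\<alpha>. (\<Prod>b\<in>Basis. ((y - x) \<bullet> b) ^ \<alpha> b) * (c \<alpha> \<bullet> i)) has_sum f y \<bullet> i)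
        (Basis \<rightarrow>\<^sub>E UNIV)" if "y \<in> ball x r" for y
      using has_sum_bounded_linear[OF bounded_linear_inner_left c[OF that], of i]
      by (simp add: o_def)
  qed
qed

section \<open>Derivatives and matrices\<close>

text \<open>The value is the sum of its rows, each put in place by the bounded linear map
  \<open>axis i\<close>.\<close>

lemma has_derivative_vecI:
  fixes f :: "'a::real_normed_vector \<Rightarrow> real^'n^'m"
  assumes "\<And>i. ((\<lambda>x. f x $ i) has_derivative (\<lambda>h. f' h $ i)) F"
  shows "(f has_derivative f') F"
proof -
  have axis_bl: "bounded_linear (axis i :: real^'n \<Rightarrow> real^'n^'m)" for i
    unfolding linear_conv_bounded_linear[symmetric]
    by (rule linearI) (auto simp: axis_def vec_eq_iff)
  have axis_sum: "(\<Sum>i\<in>UNIV. axis i (v $ i)) = v" for v :: "real^'n^'m"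
    by (simp add: vec_eq_iff axis_def if_distrib[where f = "\<lambda>v. v $ _"] cong: if_cong)
  have "((\<lambda>x. \<Sum>i\<in>UNIV. axis i (f x $ i)) has_derivative (\<lambda>h. \<Sum>i\<in>UNIV. axis i (f' h $ i))) F"
    by (intro has_derivative_sum bounded_linear.has_derivative[OF axis_bl] assms)
  then show ?thesis
    by (simp add: axis_sum)
qed

lemma jacobian_mult_eq:
  fixes f :: "real^'a \<Rightarrow> real^'b"
  assumes "(f has_derivative f') (at x)"
  shows "jacobian f (at x) *v h = f' h"
  unfolding jacobian_def frechet_derivative_at[OF assms, symmetric]
  using has_derivative_linear[OF assms] by simp

lemma invertible_mult_cancel:
  fixes A :: "real^'n^'n"
  assumes "invertible A" "A *v x = A *v y"
  shows "x = y"
proof -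
  obtain B where "B ** A = mat 1"
    using assms(1) by (auto simp: invertible_def)
  then have "z = B *v (A *v z)" for z
    by (simp add: matrix_vector_mul_assoc)
  from this[of x] this[of y] show ?thesis
    by (simp add: assms(2))
qed

section \<open>Blocks\<close>

lemma block_reshape [simp]: "block (reshape x) i = x $ i"
  by (simp add: block_def reshape_def vec_eq_iff)

lemma block_add [simp]: "block (x + y) i = block x i + block y i"
  and block_diff [simp]: "block (x - y) i = block x i - block y i"
  and block_minus [simp]: "block (- x) i = - block x i"
  and block_scaleR [simp]: "block (c *\<^sub>R x) i = c *\<^sub>R block x i"
  and block_mult [simp]: "block (x * y) i = block x i * block y i"
  and block_vdiv [simp]: "block (x \<oslash> y) i = block x i \<oslash> block y i"
  and block_one [simp]: "block 1 i = 1"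
  by (simp_all add: block_def vdiv_def vec_eq_iff)

lemma block_eqI: "(\<And>i. block x i = block y i) \<Longrightarrow> x = y"
  by (auto simp: block_def vec_eq_iff)

lemma inner_eq_sum_block: "x \<bullet> y = (\<Sum>i\<in>UNIV. block x i \<bullet> block y i)"
  by (simp add: inner_vec_def block_def sum.cartesian_product case_prod_unfold)

lemma bounded_linear_block: "bounded_linear (\<lambda>s. block s i)"
  unfolding linear_conv_bounded_linear[symmetric] by (rule linearI) simp_all

lemma bounded_linear_reshape: "bounded_linear reshape"
  unfolding linear_conv_bounded_linear[symmetric]
  by (rule linearI; rule block_eqI) simp_all

lemma block_block_matrix_mult:
  "block (block_matrix B *v d) i = (\<Sum>j\<in>UNIV. B i j *v block d j)"
  by (simp add: vec_eq_iff block_def block_matrix_def matrix_vector_mult_def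
      sum.cartesian_product case_prod_unfold)

section \<open>Centering\<close>

text \<open>This is the action of I - 1 p^T; for \<open>p \<bullet> 1 = 1\<close> it is the
  projection along the all-one vector onto the vectors orthogonal to \<open>p\<close>.\<close>

definition center :: "real^'n \<Rightarrow> real^'n \<Rightarrow> real^'n"
  where "center p x = x - (p \<bullet> x) *\<^sub>R 1"

lemma outer_mult: "outer u v *v x = (v \<bullet> x) *\<^sub>R u"
  by (simp add: outer_def matrix_vector_mult_def inner_vec_def vec_eq_iff sum_distrib_left
      sum_distrib_right mult_ac)

lemma id_minus_outer_one_mult: "(mat 1 - outer 1 p) *v x = center p x"
  by (simp add: matrix_vector_mult_diff_rdistrib outer_mult center_def)

lemma id_minus_outer_mult_one: "(mat 1 - outer p 1) *v x = x - (1 \<bullet> x) *\<^sub>R p"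
  by (simp add: matrix_vector_mult_diff_rdistrib outer_mult)

lemma diag_mult: "diag b *v x = b * x"
  by (simp add: diag_def matrix_vector_mult_def vec_eq_iff if_distrib[where f = "\<lambda>c. c * _"]
      cong: if_cong)

lemma center_add: "center p (x + y) = center p x + center p y"
  and center_diff: "center p (x - y) = center p x - center p y"
  and center_minus: "center p (- x) = - center p x"
  and center_scaleR: "center p (c *\<^sub>R x) = c *\<^sub>R center p x"
  by (simp_all add: center_def algebra_simps)

lemma center_one [simp]: "p \<bullet> 1 = 1 \<Longrightarrow> center p 1 = 0"
  by (simp add: center_def)

lemma inner_center [simp]: "p \<bullet> 1 = 1 \<Longrightarrow> p \<bullet> center p x = 0"
  by (simp add: center_def inner_diff_right)

lemma center_center [simp]: "p \<bullet> 1 = 1 \<Longrightarrow> center p (center p x) = center p x"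
  by (simp add: center_def[of p "center p x"])

lemma center_sum: "center p (\<Sum>j\<in>A. f j) = (\<Sum>j\<in>A. center p (f j))"
  by (simp add: center_def inner_sum_right scaleR_sum_left sum_subtractf)

text \<open>As \<open>p \<bullet> y = 0\<close>, the constant that \<open>center\<close> subtracts
  from \<open>f\<close> does not contribute to the \<open>p\<close>-mean of
  \<open>center p f * y\<close>. The remaining correction matches the term in the derivative of
  \<open>Fbar\<close> that comes from varying the weight \<pi>_i in \<pi>_i \<bullet>
  F_i(\<pi>).\<close>

lemma center_mult:
  assumes "p \<bullet> y = 0"
  shows "center p (center p f * y) = center p f * y - ((p * y) \<bullet> f) *\<^sub>R 1"
proof -
  have "p \<bullet> (center p f * y) = (p * y) \<bullet> f - (p \<bullet> f) * (p \<bullet> y)"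
    by (simp add: center_def inner_vec_def algebra_simps sum_subtractf sum_distrib_left)
  then show ?thesis
    using assms by (simp add: center_def)
qed

text \<open>The shift multiplies numerator and denominator by \<open>exp c\<close>.\<close>

lemma softmax_add_one: "softmax (x + c *\<^sub>R 1) = softmax x"
  by (simp add: softmax_def vec_eq_iff exp_add flip: sum_distrib_right)

lemma softmax_pos: "0 < softmax x $ a"
  unfolding softmax_def by (simp add: sum_pos)

lemma softmax_inner_one: "softmax x \<bullet> 1 = 1"
proof -
  have "(\<Sum>a\<in>UNIV. exp (x $ a)) > 0"
    by (intro sum_pos) auto
  then show ?thesis
    by (simp add: softmax_def inner_vec_def flip: sum_divide_distrib)
qed

section \<open>Derivatives\<close>

text \<open>Chain rule through the map that inserts \<open>p\<close> as row \<open>j\<close>; its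
  derivative inserts the increment there and is zero in all other rows.\<close>

lemma partial_jacobian_mult:
  assumes F': "(F has_derivative F') (at \<pi>)"
  shows "partial_jacobian F \<pi> i j *v v = F' (\<chi> l. if l = j then v else 0) $ i"
proof -
  let ?u = "\<lambda>p. \<chi> l. if l = j then p else \<pi> $ l"
  have "((\<lambda>p. if l = j then p else \<pi> $ l) has_derivative (\<lambda>h. if l = j then h else 0))
      (at (\<pi> $ j))" for l
    by (cases "l = j") simp_all
  then have "(?u has_derivative (\<lambda>h. \<chi> l. if l = j then h else 0)) (at (\<pi> $ j))"
    by (intro has_derivative_vecI) simp
  moreover have "?u (\<pi> $ j) = \<pi>"
    by (simp add: vec_eq_iff)
  then have "(F has_derivative F') (at (?u (\<pi> $ j)))"
    using F' by simp
  ultimately have "((\<lambda>p. F (?u p)) has_derivative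
      (\<lambda>h. F' (\<chi> l. if l = j then h else 0))) (at (\<pi> $ j))"
    by (rule has_derivative_compose)
  then show ?thesis
    unfolding partial_jacobian_def
    by (intro jacobian_mult_eq bounded_linear.has_derivative[OF bounded_linear_vec_nth])
qed

text \<open>\<open>v\<close> is the sum of its parts supported in a single row, and
  \<open>F'\<close> is linear.\<close>

lemma sum_partial_jacobian_mult:
  fixes F :: "real^'n^'m \<Rightarrow> real^'n^'m"
  assumes F': "(F has_derivative F') (at \<pi>)"
  shows "(\<Sum>j\<in>UNIV. partial_jacobian F \<pi> i j *v v $ j) = F' v $ i"
proof -
  have v: "v = (\<Sum>j\<in>UNIV. \<chi> l. if l = j then v $ j else 0)"
    by (simp add: vec_eq_iff if_distrib[where f = "\<lambda>v. v $ _"] cong: if_cong)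
  \<comment> \<open>The variable \<open>v\<close> occurs on both sides of its decomposition, so the
    one intended occurrence is replaced by congruence instead of rewriting.\<close>
  have "F' v $ i = F' (\<Sum>j\<in>UNIV. \<chi> l. if l = j then v $ j else 0) $ i"
    by (rule arg_cong[OF v, where f = "\<lambda>v. F' v $ i"])
  also have "\<dots> = (\<Sum>j\<in>UNIV. F' (\<chi> l. if l = j then v $ j else 0) $ i)"
    by (simp add: linear_sum[OF has_derivative_linear[OF F']])
  finally show ?thesis
    by (simp add: partial_jacobian_mult[OF F'])
qed

lemma phi_inv_w_phi:
  assumes "\<And>i. \<pi> $ i \<bullet> 1 = 1"
  shows "phi_inv_w (phi \<pi> w) = w"
  using assms by (simp add: phi_inv_w_def block_sums_def phi_def odot_def vec_eq_iff inner_commute)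

lemma phi_inv_pi_phi:
  assumes "\<And>i. \<pi> $ i \<bullet> 1 = 1" and "\<And>i. w $ i \<noteq> 0"
  shows "phi_inv_pi (phi \<pi> w) = \<pi>"
  using assms by (simp add: phi_inv_pi_def phi_def odot_def vec_eq_iff inner_commute)

lemma block_phi [simp]: "block (phi \<pi> w) i = w $ i *\<^sub>R \<pi> $ i"
  by (simp add: phi_def odot_def)

lemma block_Fbar:
  "block (Fbar F s) i = (1 / (1 \<bullet> block s i)) *\<^sub>R center (phi_inv_pi s $ i) (F (phi_inv_pi s) $ i)"
  by (simp add: Fbar_def Let_def center_def phi_inv_w_def block_sums_def)

lemma has_derivative_inverse_block_sum:
  fixes \<pi> :: "real^'n^'m"
  assumes \<pi>: "\<And>i. \<pi> $ i \<bullet> 1 = 1" and w: "w $ i \<noteq> 0"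
  shows "((\<lambda>s. inverse (1 \<bullet> block s i)) has_derivative
      (\<lambda>h. - ((1 \<bullet> block h i) / (w $ i)\<^sup>2))) (at (phi \<pi> w))"
proof -
  have sum: "1 \<bullet> block (phi \<pi> w) i = w $ i"
    using \<pi> by (simp add: inner_commute)
  have "((\<lambda>s :: real^('m \<times> 'n). 1 \<bullet> block s i) has_derivative (\<lambda>h. 1 \<bullet> block h i)) (at (phi \<pi> w))"
    by (intro has_derivative_inner_right bounded_linear_imp_has_derivative bounded_linear_block)
  then have "((\<lambda>s. inverse (1 \<bullet> block s i)) has_derivative
      (\<lambda>h. - (inverse (1 \<bullet> block (phi \<pi> w) i) * (1 \<bullet> block h i) *
        inverse (1 \<bullet> block (phi \<pi> w) i)))) (at (phi \<pi> w))"
    by (rule Deriv.has_derivative_inverse[rotated]) (use w sum in simp)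
  then show ?thesis
    unfolding sum by (simp add: divide_inverse power2_eq_square mult_ac)
qed

text \<open>Product rule for the inverse block sum times the block: at the block w_i \<pi>_i,
  varying the first factor contributes -((1 \<bullet> h_i) / w_i) \<pi>_i.\<close>

lemma has_derivative_phi_inv_pi:
  fixes \<pi> :: "real^'n^'m"
  assumes \<pi>: "\<And>i. \<pi> $ i \<bullet> 1 = 1" and w: "\<And>i. w $ i \<noteq> 0"
  shows "(phi_inv_pi has_derivative
      (\<lambda>h. \<chi> i. (1 / w $ i) *\<^sub>R (block h i - (1 \<bullet> block h i) *\<^sub>R \<pi> $ i))) (at (phi \<pi> w))"
proof (rule has_derivative_vecI)
  fix i
  have sum: "1 \<bullet> \<pi> $ i = 1"
    using \<pi> by (simp add: inner_commute)
  have "((\<lambda>s. inverse (1 \<bullet> block s i) *\<^sub>R block s i) has_derivative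
      (\<lambda>h. (1 / w $ i) *\<^sub>R (block h i - (1 \<bullet> block h i) *\<^sub>R \<pi> $ i))) (at (phi \<pi> w))"
    by (rule has_derivative_eq_rhs[OF has_derivative_scaleR[OF
            has_derivative_inverse_block_sum[OF \<pi> w] bounded_linear_imp_has_derivative[OF bounded_linear_block]]])
      (use w[of i] in \<open>simp add: sum fun_eq_iff divide_inverse scaleR_diff_right power2_eq_square\<close>)
  then show "((\<lambda>s. phi_inv_pi s $ i) has_derivative
      (\<lambda>h. (\<chi> i. (1 / w $ i) *\<^sub>R (block h i - (1 \<bullet> block h i) *\<^sub>R \<pi> $ i)) $ i)) (at (phi \<pi> w))"
    by (simp add: phi_inv_pi_def divide_inverse)
qed

text \<open>The part with \<open>d\<pi>\<close> is the chain rule through \<open>phi_inv_pi\<close>,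
  where the inner product with \<open>F \<pi> $ i\<close> comes from varying the weight in \<pi>_i
  \<bullet> F_i(\<pi>); the last term is the derivative of the prefactor 1/w_i.\<close>

lemma has_derivative_Fbar:
  fixes F :: "real^'n^'m \<Rightarrow> real^'n^'m"
  assumes F': "(F has_derivative F') (at \<pi>)"
    and \<pi>: "\<And>i. \<pi> $ i \<bullet> 1 = 1" and w: "\<And>i. w $ i \<noteq> 0"
  defines "d\<pi> \<equiv> \<lambda>h. \<chi> i. (1 / w $ i) *\<^sub>R (block h i - (1 \<bullet> block h i) *\<^sub>R \<pi> $ i)"
  shows "(Fbar F has_derivative (\<lambda>h. reshape (\<chi> i.
      (1 / w $ i) *\<^sub>R (center (\<pi> $ i) (F' (d\<pi> h) $ i) - (d\<pi> h $ i \<bullet> F \<pi> $ i) *\<^sub>R 1)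
      - ((1 \<bullet> block h i) / (w $ i)\<^sup>2) *\<^sub>R center (\<pi> $ i) (F \<pi> $ i)))) (at (phi \<pi> w))"
    (is "(_ has_derivative (\<lambda>h. reshape (?D h))) _")
proof -
  let ?\<sigma> = "phi \<pi> w"
  let ?R = "\<lambda>s. \<chi> i. inverse (1 \<bullet> block s i) *\<^sub>R
      (F (phi_inv_pi s) $ i - (phi_inv_pi s $ i \<bullet> F (phi_inv_pi s) $ i) *\<^sub>R 1)"
  have inv: "phi_inv_pi ?\<sigma> = \<pi>"
    by (rule phi_inv_pi_phi[OF \<pi> w])
  have p: "(phi_inv_pi has_derivative d\<pi>) (at ?\<sigma>)"
    unfolding d\<pi>_def by (rule has_derivative_phi_inv_pi[OF \<pi> w])
  have "((\<lambda>s. F (phi_inv_pi s)) has_derivative (\<lambda>h. F' (d\<pi> h))) (at ?\<sigma>)"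
    using p F' by (intro has_derivative_compose[OF p]) (simp add: inv)
  note Fp = bounded_linear.has_derivative[OF bounded_linear_vec_nth this]
  note pi = bounded_linear.has_derivative[OF bounded_linear_vec_nth p]
  have "(?R has_derivative ?D) (at ?\<sigma>)"
  proof (rule has_derivative_vecI)
    fix i
    have sum: "1 \<bullet> \<pi> $ i = 1"
      using \<pi> by (simp add: inner_commute)
      have "((\<lambda>s. inverse (1 \<bullet> block s i) *\<^sub>R
        (F (phi_inv_pi s) $ i - (phi_inv_pi s $ i \<bullet> F (phi_inv_pi s) $ i) *\<^sub>R 1)) has_derivative
        (\<lambda>h. ?D h $ i)) (at ?\<sigma>)"
      by (rule has_derivative_eq_rhs[OF has_derivative_scaleR[OF
              has_derivative_inverse_block_sum[OF \<pi> w] has_derivative_diff[OF Fp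
              has_derivative_scaleR_left[OF has_derivative_inner[OF pi Fp]]]]])
        (use w[of i] in \<open>simp add: sum fun_eq_iff inv center_def divide_inverse algebra_simps\<close>)
    then show "((\<lambda>s. ?R s $ i) has_derivative (\<lambda>h. ?D h $ i)) (at ?\<sigma>)"
      by simp
  qed
  then have "((\<lambda>s. reshape (?R s)) has_derivative (\<lambda>h. reshape (?D h))) (at ?\<sigma>)"
    by (rule bounded_linear.has_derivative[OF bounded_linear_reshape])
  moreover have "(\<lambda>s. reshape (?R s)) = Fbar F"
    by (rule ext, rule block_eqI) (simp add: block_Fbar center_def divide_inverse)
  ultimately show ?thesis
    by simp
qed

section \<open>The coefficient matrices\<close>

text \<open>Orthogonality of y_j to \<pi>_j makes the right projector act as the identity and
  annihilates the rank-one term; the partial derivatives then add up to the full derivative along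
  \<pi> \<circ> y.\<close>

lemma block_J_mult:
  fixes F :: "real^'n^'m \<Rightarrow> real^'n^'m"
  assumes F': "(F has_derivative F') (at \<pi>)" and y: "\<And>j. \<pi> $ j \<bullet> block y j = 0"
  shows "block (block_matrix (J_block F k \<pi> \<tau>) *v y) i =
    center (\<pi> $ i) (F' (\<chi> j. \<pi> $ j * block y j) $ i + center (\<pi> $ i) (F \<pi> $ i) * block y i)"
proof -
  have "J_block F k \<pi> \<tau> i j *v block y j = center (\<pi> $ i)
      (partial_jacobian F \<pi> i j *v (\<pi> $ j * block y j) +
        (if i = j then center (\<pi> $ i) (F \<pi> $ i) * block y j else 0))" for j
    by (simp add: J_block_def Let_def matrix_vector_mult_add_rdistrib outer_mult
        id_minus_outer_one_mult diag_mult y scaleR_matrix_vector_assoc[symmetric]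
        center_def[of "\<pi> $ j" "block y j"] flip: matrix_vector_mul_assoc)
  then have "block (block_matrix (J_block F k \<pi> \<tau>) *v y) i = center (\<pi> $ i)
      ((\<Sum>j\<in>UNIV. partial_jacobian F \<pi> i j *v (\<pi> $ j * block y j)) +
        (\<Sum>j\<in>UNIV. if i = j then center (\<pi> $ i) (F \<pi> $ i) * block y j else 0))"
    by (simp add: block_block_matrix_mult sum.distrib flip: center_sum)
  then show ?thesis
    using sum_partial_jacobian_mult[OF F', of i "\<chi> j. \<pi> $ j * block y j"] by simp
qed

text \<open>Up to the factor 1/w_i, the right-hand side is the block of J y found in
  \<open>block_J_mult\<close>.\<close>

lemma block_Jbar_mult:
  fixes F :: "real^'n^'m \<Rightarrow> real^'n^'m"
  assumes F': "(F has_derivative F') (at \<pi>)"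
    and \<pi>: "\<And>i. \<pi> $ i \<bullet> 1 = 1" and w: "\<And>i. w $ i \<noteq> 0"
    and x: "phi \<pi> w \<bullet> x = 0" and y: "\<And>i. block y i = center (\<pi> $ i) (block x i)"
  shows "block (Jbar F k (phi \<pi> w) *v x) i = (1 / w $ i) *\<^sub>R
    center (\<pi> $ i) (F' (\<chi> j. \<pi> $ j * block y j) $ i + center (\<pi> $ i) (F \<pi> $ i) * block y i)"
    (is "_ = (1 / w $ i) *\<^sub>R ?V i")
proof -
  let ?\<sigma> = "phi \<pi> w"
  let ?U = "jacobian (Fbar F) (at ?\<sigma>) *v (?\<sigma> * x) + Fbar F ?\<sigma> * x"
  have \<pi>_y: "\<pi> $ i \<bullet> block y i = 0" for i
    using \<pi> by (simp add: y)
  have sum: "1 \<bullet> \<pi> $ i = 1" for i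
    using \<pi> by (simp add: inner_commute)
  have Fbar_\<sigma>: "block (Fbar F ?\<sigma>) i = (1 / w $ i) *\<^sub>R center (\<pi> $ i) (F \<pi> $ i)" for i
    by (simp add: block_Fbar phi_inv_pi_phi \<pi> w sum)
  then have "?\<sigma> \<bullet> Fbar F ?\<sigma> = 0"
    by (simp add: inner_eq_sum_block \<pi>)
  \<comment> \<open>So the inner centering in the diagonal term of \<open>Jbar\<close> leaves
    \<open>Fbar\<close> unchanged.\<close>
  then have center_Fbar: "center ?\<sigma> (Fbar F ?\<sigma>) = Fbar F ?\<sigma>"
    by (simp add: center_def)
  have one_h: "1 \<bullet> block (?\<sigma> * x) i = w $ i * (\<pi> $ i \<bullet> block x i)" for i
    by (simp add: inner_vec_def sum_distrib_left mult_ac)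
  \<comment> \<open>The direction in which \<open>phi_inv_pi\<close> moves when its argument moves
    along \<sigma> \<circ> x.\<close>
  have d\<pi>: "(1 / w $ i) *\<^sub>R (block (?\<sigma> * x) i - (1 \<bullet> block (?\<sigma> * x) i) *\<^sub>R \<pi> $ i) = \<pi> $ i * block y i" for i
    using w[of i] unfolding one_h y by (simp add: center_def vec_eq_iff field_simps)
  have U: "block ?U i = (1 / w $ i) *\<^sub>R ?V i" for i
  proof -
    let ?d = "F' (\<chi> j. \<pi> $ j * block y j) $ i" and ?s = "\<pi> $ i \<bullet> block x i"
      and ?c = "center (\<pi> $ i) (F \<pi> $ i)"
    have "block (jacobian (Fbar F) (at ?\<sigma>) *v (?\<sigma> * x)) i = (1 / w $ i) *\<^sub>R
        (center (\<pi> $ i) ?d - ((\<pi> $ i * block y i) \<bullet> F \<pi> $ i) *\<^sub>R 1) - (?s / w $ i) *\<^sub>R ?c"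
      unfolding jacobian_mult_eq[OF has_derivative_Fbar[OF F' \<pi> w]] d\<pi> block_reshape vec_lambda_beta
      unfolding one_h using w[of i] by (simp add: power2_eq_square)
    \<comment> \<open>Here x_i = y_i + \<open>?s *\<^sub>R 1\<close>. The term with
      \<open>?s\<close> cancels the last term of the preceding formula, which stems from the varying
      block sum.\<close>
    moreover have "block (Fbar F ?\<sigma> * x) i = (1 / w $ i) *\<^sub>R (?c * block y i + ?s *\<^sub>R ?c)"
      by (simp add: Fbar_\<sigma> y center_def vec_eq_iff algebra_simps)
    ultimately show ?thesis
      unfolding center_add center_mult[OF \<pi>_y] by (simp add: algebra_simps)
  qed
  \<comment> \<open>Every block of \<open>?U\<close> is orthogonal to \<pi>_i, so the left projector
    of \<open>Jbar\<close> fixes \<open>?U\<close>; the right one fixes \<open>x\<close>, and the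
    rank-one term vanishes on \<open>x\<close>.\<close>
  have "?\<sigma> \<bullet> ?U = 0"
    by (simp only: inner_eq_sum_block U) (simp add: \<pi>)
  then have "center ?\<sigma> ?U = ?U"
    by (simp add: center_def)
  moreover have "center ?\<sigma> x = x"
    using x by (simp add: center_def)
  ultimately have "Jbar F k ?\<sigma> *v x = ?U"
    by (simp add: Jbar_def matrix_vector_mult_add_rdistrib outer_mult x id_minus_outer_one_mult
        diag_mult center_Fbar scaleR_matrix_vector_assoc[symmetric] flip: matrix_vector_mul_assoc)
  then show ?thesis
    by (simp only: U)
qed

text \<open>The Jacobian parts agree by \<open>block_J_mult\<close> and
  \<open>block_Jbar_mult\<close>. The scalar parts agree because 1 \<bullet> \<tau>_i = c w_i:
  centering c x_i and multiplying by w_i gives (1 \<bullet> \<tau>_i) y_i.\<close>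

lemma coeff_pi_mult_center:
  fixes F :: "real^'n^'m \<Rightarrow> real^'n^'m"
  assumes F': "(F has_derivative F') (at \<pi>)"
    and \<pi>: "\<And>i. \<pi> $ i \<bullet> 1 = 1" and w: "\<And>i. w $ i \<noteq> 0"
    and x: "phi \<pi> w \<bullet> x = 0"
    and \<mu>: "1 \<bullet> \<mu> = c" and \<tau>: "row_sums \<tau> = c *\<^sub>R w"
  shows "coeff_pi F k \<pi> \<tau> *v reshape (\<chi> i. center (\<pi> $ i) (block x i)) =
    reshape (\<chi> i. w $ i *\<^sub>R center (\<pi> $ i) (block (coeff_sigma F k (phi \<pi> w) \<mu> *v x) i))"
    (is "_ *v ?y = _")
proof (rule block_eqI)
  fix i
  have y: "block ?y j = center (\<pi> $ j) (block x j)" for j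
    by simp
  let ?V = "center (\<pi> $ i) (F' (\<chi> j. \<pi> $ j * block ?y j) $ i +
    center (\<pi> $ i) (F \<pi> $ i) * block ?y i)"
  have \<tau>_i: "1 \<bullet> \<tau> $ j = c * w $ j" for j
    using \<tau> by (simp add: row_sums_def vec_eq_iff)
  have "(if i = j then (c * w $ i) *\<^sub>R mat 1 else 0) *v z =
      (if i = j then (c * w $ i) *\<^sub>R z else 0)" for j and z :: "real^'n"
    by (simp add: scaleR_matrix_vector_assoc[symmetric])
  then have "block (coeff_pi F k \<pi> \<tau> *v ?y) i = ?V + (c * w $ i) *\<^sub>R block ?y i"
    unfolding coeff_pi_def matrix_vector_mult_add_rdistrib block_add \<tau>_i
    using \<pi> by (subst block_J_mult[OF F']) (simp_all add: block_block_matrix_mult)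
  moreover have "block (coeff_sigma F k (phi \<pi> w) \<mu> *v x) i = (1 / w $ i) *\<^sub>R ?V + c *\<^sub>R block x i"
    unfolding coeff_sigma_def matrix_vector_mult_add_rdistrib block_add \<mu>
      block_Jbar_mult[OF F' \<pi> w x y]
    by (simp add: scaleR_matrix_vector_assoc[symmetric])
  ultimately show "block (coeff_pi F k \<pi> \<tau> *v ?y) i = block (reshape (\<chi> i. w $ i *\<^sub>R
      center (\<pi> $ i) (block (coeff_sigma F k (phi \<pi> w) \<mu> *v x) i))) i"
    using w[of i] \<pi> by (simp add: center_add center_scaleR algebra_simps)
qed

section \<open>Right-hand sides and increments\<close>

text \<open>Centering the whole vector changes each block by a multiple of the all-one vector, which
  \<open>center p\<close> annihilates.\<close>

lemma center_block_center:
  "p \<bullet> 1 = 1 \<Longrightarrow> center p (block (center s v) i) = center p (block v i)"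
  by (simp add: center_def[of s v] center_diff center_scaleR)

lemma scaleR_vdiv_scaleR: "c \<noteq> 0 \<Longrightarrow> c *\<^sub>R (x \<oslash> (c *\<^sub>R y)) = x \<oslash> y"
  by (simp add: vdiv_def vec_eq_iff)

lemma mult_diff_vdiv:
  assumes "\<And>a. p $ a \<noteq> 0"
  shows "(p * f - t - c *\<^sub>R p) \<oslash> p = f - t \<oslash> p - c *\<^sub>R 1"
  using assms by (simp add: vdiv_def vec_eq_iff diff_divide_distrib)

text \<open>The blockwise centering absorbs the global one, and the factor w_i cancels the one in
  the denominator \<sigma>_i = w_i \<pi>_i.\<close>

lemma differential_rhs:
  assumes \<pi>: "\<And>i. \<pi> $ i \<bullet> 1 = 1" and w: "\<And>i. w $ i \<noteq> 0"
  shows "w $ i *\<^sub>R center (\<pi> $ i)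
      (block ((mat 1 - outer 1 (phi \<pi> w)) *v (reshape d\<tau> \<oslash> phi \<pi> w)) i) =
    (mat 1 - outer 1 (\<pi> $ i)) *v (d\<tau> $ i \<oslash> \<pi> $ i)"
  using \<pi> w
  by (simp add: id_minus_outer_one_mult center_block_center scaleR_vdiv_scaleR flip: center_scaleR)

text \<open>After division by \<sigma>, the projection in \<open>Gbar\<close> only subtracts a
  constant, which blockwise centering removes; the factor w_i then cancels the weights in
  \<open>Fbar\<close> and in \<tau>_i / \<sigma>_i.\<close>

lemma newton_rhs:
  assumes \<pi>: "\<And>i. \<pi> $ i \<bullet> 1 = 1" and \<pi>_nz: "\<And>i a. \<pi> $ i $ a \<noteq> 0" and w: "\<And>i. w $ i \<noteq> 0"
  shows "w $ i *\<^sub>R center (\<pi> $ i)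
      (block (Gbar F (phi \<pi> w) (reshape \<tau>) \<oslash> phi \<pi> w) i) = G F \<pi> \<tau> $ i \<oslash> \<pi> $ i"
proof -
  let ?\<sigma> = "phi \<pi> w"
  let ?c = "1 \<bullet> (?\<sigma> * Fbar F ?\<sigma> - reshape \<tau>)"
  have sum: "1 \<bullet> \<pi> $ i = 1"
    using \<pi> by (simp add: inner_commute)
  have "?\<sigma> $ p \<noteq> 0" for p
    using \<pi>_nz w by (simp add: phi_def odot_def reshape_def)
  then have "Gbar F ?\<sigma> (reshape \<tau>) \<oslash> ?\<sigma> = Fbar F ?\<sigma> - reshape \<tau> \<oslash> ?\<sigma> - ?c *\<^sub>R 1"
    unfolding Gbar_def id_minus_outer_mult_one by (rule mult_diff_vdiv)
  then have "w $ i *\<^sub>R center (\<pi> $ i) (block (Gbar F ?\<sigma> (reshape \<tau>) \<oslash> ?\<sigma>) i) =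
      w $ i *\<^sub>R center (\<pi> $ i) (block (Fbar F ?\<sigma>) i) -
      center (\<pi> $ i) (w $ i *\<^sub>R (\<tau> $ i \<oslash> (w $ i *\<^sub>R \<pi> $ i)))"
    using \<pi> by (simp add: center_diff center_scaleR scaleR_diff_right)
  also have "\<dots> = center (\<pi> $ i) (F \<pi> $ i) - center (\<pi> $ i) (\<tau> $ i \<oslash> \<pi> $ i)"
    using \<pi> w[of i] sum by (simp add: block_Fbar phi_inv_pi_phi w center_scaleR scaleR_vdiv_scaleR)
  \<comment> \<open>The two constants removed by centering combine to the coefficient of \<pi>_i in
    the projection that defines \<open>G\<close>.\<close>
  also have "\<dots> = F \<pi> $ i - \<tau> $ i \<oslash> \<pi> $ i - (1 \<bullet> (\<pi> $ i * F \<pi> $ i - \<tau> $ i)) *\<^sub>R 1"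
  proof -
    have "\<pi> $ i \<bullet> (\<tau> $ i \<oslash> \<pi> $ i) = 1 \<bullet> \<tau> $ i"
      using \<pi>_nz by (simp add: inner_vec_def vdiv_def)
    moreover have "1 \<bullet> (\<pi> $ i * F \<pi> $ i) = \<pi> $ i \<bullet> F \<pi> $ i"
      by (simp add: inner_vec_def)
    ultimately show ?thesis
      by (simp add: center_def inner_diff_right algebra_simps)
  qed
  also have "\<dots> = G F \<pi> \<tau> $ i \<oslash> \<pi> $ i"
    using \<pi>_nz by (simp add: G_def id_minus_outer_mult_one mult_diff_vdiv)
  finally show ?thesis .
qed

text \<open>Common core of the differential and Newton updates: each supplies the assumption on
  \<open>z\<close>. By \<open>coeff_pi_mult_center\<close> the blockwise centered \<open>x\<close>
  solves the same equation, hence equals \<open>z\<close>, and \<open>softmax\<close> does not see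
  the difference from \<open>x\<close>.\<close>

lemma update_sigma_phi:
  assumes F': "(F has_derivative F') (at \<pi>)"
    and \<pi>: "\<And>i. \<pi> $ i \<bullet> 1 = 1" and w: "\<And>i. w $ i \<noteq> 0"
    and \<mu>: "1 \<bullet> \<mu> = c" and \<tau>: "row_sums \<tau> = c *\<^sub>R w"
    and inv: "invertible (coeff_pi F k \<pi> \<tau>)"
    and x: "projected_sigma (phi \<pi> w) x"
    and z: "coeff_pi F k \<pi> \<tau> *v z =
      reshape (\<chi> i. w $ i *\<^sub>R center (\<pi> $ i) (block (coeff_sigma F k (phi \<pi> w) \<mu> *v x) i))"
    and w_sum: "(\<Sum>i\<in>UNIV. w $ i) = 1"
  shows "update_sigma (phi \<pi> w) x = phi (update_pi \<pi> z) w"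
proof -
  have "phi \<pi> w \<bullet> 1 = 1"
    by (simp add: inner_eq_sum_block \<pi> w_sum)
  then have x0: "phi \<pi> w \<bullet> x = 0"
    using x by (auto simp: projected_sigma_def id_minus_outer_one_mult)
  have "coeff_pi F k \<pi> \<tau> *v z =
      coeff_pi F k \<pi> \<tau> *v reshape (\<chi> i. center (\<pi> $ i) (block x i))"
    unfolding z coeff_pi_mult_center[OF F' \<pi> w x0 \<mu> \<tau>] by (rule refl)
  then have z_eq: "z = reshape (\<chi> i. center (\<pi> $ i) (block x i))"
    by (rule invertible_mult_cancel[OF inv])
  have "softmax (vln (\<pi> $ i) + block x i) = softmax (vln (\<pi> $ i) + block z i)" for i
  proof -
    have "vln (\<pi> $ i) + block x i =
        vln (\<pi> $ i) + block z i + (\<pi> $ i \<bullet> block x i) *\<^sub>R 1"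
      by (simp add: z_eq center_def)
    then show ?thesis
      by (simp only: softmax_add_one)
  qed
  then show ?thesis
    by (intro block_eqI)
      (simp add: update_sigma_def update_pi_def phi_inv_w_phi[OF \<pi>] phi_inv_pi_phi[OF \<pi> w])
qed

section \<open>The invariant of the iterations\<close>

text \<open>The row sums are tied to \<open>w\<close> by a scalar multiple, a relation that every
  update preserves. This scalar is only required to be nonzero, since a shift with negative \<beta>
  may change its sign. Positivity of \<pi> permits the divisions by \<pi>_i and places \<pi> in the
  product of simplices.\<close>

definition coupled :: "real^'m \<Rightarrow>
    (real^('m \<times> 'n)) \<times> (real^('m \<times> 'n)) \<times> (real^'n^'m) \<times> (real^'n^'m) \<Rightarrow> bool"
  where "coupled w = (\<lambda>(\<sigma>, \<mu>, \<pi>, \<tau>). \<sigma> = phi \<pi> w \<and> \<mu> = reshape \<tau> \<and>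
    (\<forall>i. \<pi> $ i \<bullet> 1 = 1) \<and> (\<forall>i a. 0 < \<pi> $ i $ a) \<and>
    1 \<bullet> \<mu> \<noteq> 0 \<and> row_sums \<tau> = (1 \<bullet> \<mu>) *\<^sub>R w)"

lemma sum_normalize_scaleR:
  assumes "c \<noteq> 0" "(\<Sum>i\<in>UNIV. w $ i) = 1"
  shows "sum_normalize (c *\<^sub>R w) = w"
  using assms by (simp add: sum_normalize_def vec_eq_iff flip: sum_distrib_left)

text \<open>Values of \<open>softmax\<close> are positive and sum to 1, so only the relation between
  \<sigma> and \<pi> has to be supplied.\<close>

lemma coupled_update:
  assumes cpl: "coupled w (\<sigma>, \<mu>, \<pi>, \<tau>)" and "update_sigma \<sigma> x = phi (update_pi \<pi> z) w"
  shows "coupled w (update_sigma \<sigma> x, \<mu>, update_pi \<pi> z, \<tau>)"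
proof -
  have "update_pi \<pi> z $ i \<bullet> 1 = 1" "0 < update_pi \<pi> z $ i $ a" for i a
    by (simp_all add: update_pi_def softmax_inner_one softmax_pos)
  then show ?thesis
    using assms unfolding coupled_def prod.case by blast
qed

lemma coupled_joint_step:
  fixes F :: "real^'n^'m \<Rightarrow> real^'n^'m"
  assumes diff: "\<And>\<pi>. \<pi> \<in> simplex_prod \<Longrightarrow> F differentiable (at \<pi>)"
    and w: "w \<in> open_simplex"
    and step: "joint_step F k s s'" and cpl: "coupled w s"
  shows "coupled w s'"
proof -
  have w_nz: "w $ i \<noteq> 0" for i
    using w by (auto simp: open_simplex_def less_imp_neq[THEN not_sym])
  have w_sum: "(\<Sum>i\<in>UNIV. w $ i) = 1"
    using w by (simp add: open_simplex_def)
  have deriv: "\<exists>F'. (F has_derivative F') (at \<pi>)" if "coupled w (\<sigma>, \<mu>, \<pi>, \<tau>)" for \<sigma> \<mu> \<pi> \<tau>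
  proof -
    have "\<pi> \<in> simplex_prod"
      using that by (auto simp: coupled_def simplex_prod_def unit_simplex_def inner_vec_def less_imp_le)
    then show ?thesis
      using diff by (simp add: differentiable_def)
  qed
  show ?thesis
    using step cpl
  proof (cases rule: joint_step.cases)
    case (scale \<eta> \<sigma> \<mu> \<pi> \<tau>)
    then show ?thesis
      using cpl by (auto simp: coupled_def row_sums_def vec_eq_iff reshape_def mult_ac)
  next
    case (shift \<mu> \<beta> \<sigma> \<pi> \<tau>)
    have c: "\<sigma> = phi \<pi> w" "\<mu> = reshape \<tau>" "\<And>i. \<pi> $ i \<bullet> 1 = 1" "\<And>i a. 0 < \<pi> $ i $ a"
        "1 \<bullet> \<mu> \<noteq> 0" "row_sums \<tau> = (1 \<bullet> \<mu>) *\<^sub>R w"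
      using cpl shift by (auto simp: coupled_def)
    have norm: "sum_normalize (row_sums \<tau>) = w"
      by (simp add: c(5,6) sum_normalize_scaleR w_sum)
    \<comment> \<open>Hence the shift raises \<open>1 \<bullet> \<mu>\<close> by exactly \<beta>,
      and the condition on \<beta> keeps it nonzero.\<close>
    have "1 \<bullet> \<sigma> = 1"
      using c(3) by (simp add: c(1) inner_eq_sum_block w_sum inner_commute)
    moreover have "reshape (\<tau> + \<beta> *\<^sub>R (w \<odot> \<pi>)) = \<mu> + \<beta> *\<^sub>R \<sigma>"
      by (rule block_eqI) (simp add: c(1,2) odot_def)
    moreover have "row_sums (\<tau> + \<beta> *\<^sub>R (w \<odot> \<pi>)) = row_sums \<tau> + \<beta> *\<^sub>R w"
      using c(3) by (simp add: row_sums_def odot_def vec_eq_iff inner_add_right inner_commute)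
    ultimately show ?thesis
      unfolding shift(2) norm using c shift(3)
      by (simp add: coupled_def inner_add_right scaleR_add_left)
  next
    case (differential \<sigma> \<mu> \<pi> \<tau> x z d\<mu> \<kappa> d\<tau>)
    have c: "\<sigma> = phi \<pi> w" "\<mu> = reshape \<tau>" "\<And>i. \<pi> $ i \<bullet> 1 = 1" "row_sums \<tau> = (1 \<bullet> \<mu>) *\<^sub>R w"
      and cpl': "coupled w (\<sigma>, \<mu>, \<pi>, \<tau>)"
      using cpl differential by (auto simp: coupled_def)
    obtain F' where F': "(F has_derivative F') (at \<pi>)"
      using deriv[OF cpl'] by blast
    \<comment> \<open>Both increments carry the same factor \<kappa>, so they inherit the relation
      between \<mu> and \<tau>.\<close>
    have d\<mu>: "d\<mu> = reshape d\<tau>"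
      by (rule block_eqI) (simp add: differential c(2))
    have "coeff_pi F k \<pi> \<tau> *v z =
        reshape (\<chi> i. w $ i *\<^sub>R center (\<pi> $ i) (block (coeff_sigma F k (phi \<pi> w) \<mu> *v x) i))"
      using differential(9,10) unfolding differential_eq_sigma_def differential_eq_pi_def c(1) d\<mu>
      by (simp add: differential_rhs[OF c(3) w_nz])
    then have "update_sigma \<sigma> x = phi (update_pi \<pi> z) w"
      using differential(4,5) unfolding c(1)
      by (intro update_sigma_phi[OF F' c(3) w_nz refl c(4) _ _ _ w_sum]) simp_all
    then show ?thesis
      using coupled_update[OF cpl'] differential(2) by simp
  next
    case (newton \<sigma> \<mu> \<pi> \<tau> x z)
    have c: "\<sigma> = phi \<pi> w" "\<mu> = reshape \<tau>" "\<And>i. \<pi> $ i \<bullet> 1 = 1" "row_sums \<tau> = (1 \<bullet> \<mu>) *\<^sub>R w"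
      and \<pi>_pos: "\<And>i a. 0 < \<pi> $ i $ a"
      and cpl': "coupled w (\<sigma>, \<mu>, \<pi>, \<tau>)"
      using cpl newton by (auto simp: coupled_def)
    obtain F' where F': "(F has_derivative F') (at \<pi>)"
      using deriv[OF cpl'] by blast
    have "coeff_pi F k \<pi> \<tau> *v z =
        reshape (\<chi> i. w $ i *\<^sub>R center (\<pi> $ i) (block (coeff_sigma F k (phi \<pi> w) \<mu> *v x) i))"
    proof (rule block_eqI)
      fix i
      have "\<pi> $ i $ a \<noteq> 0" for i a
        using \<pi>_pos[of i a] by simp
      from newton_rhs[OF c(3) this w_nz, of i F \<tau>]
      show "block (coeff_pi F k \<pi> \<tau> *v z) i = block (reshape (\<chi> i. w $ i *\<^sub>R
          center (\<pi> $ i) (block (coeff_sigma F k (phi \<pi> w) \<mu> *v x) i))) i"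
        using newton(7,8) unfolding newton_eq_sigma_def newton_eq_pi_def c(1,2)
        by (simp add: center_minus)
    qed
    then have "update_sigma \<sigma> x = phi (update_pi \<pi> z) w"
      using newton(4,5) unfolding c(1)
      by (intro update_sigma_phi[OF F' c(3) w_nz refl c(4) _ _ _ w_sum]) simp_all
    then show ?thesis
      using coupled_update[OF cpl'] newton(2) by simp
  qed
qed

theorem theorem13:
  fixes F :: "real^'n^'m \<Rightarrow> real^'n^'m"
    and U :: "(real^'n^'m) set"
    and k v_init :: real
    and w_init :: "real^'m"
    and \<pi>_init \<pi> \<tau> :: "real^'n^'m"
    and \<sigma>_init \<sigma> \<mu> :: "real^('m \<times> 'n)"
  assumes "open U" and "simplex_prod \<subseteq> U" and "real_analytic_on F U"
    and "w_init \<in> open_simplex"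
    and "\<pi>_init \<in> simplex_prod" and "\<And>i a. 0 < \<pi>_init $ i $ a"
    and "0 < v_init"
    and "\<sigma>_init = phi \<pi>_init w_init"
    and "(joint_step F k)\<^sup>*\<^sup>*
      (\<sigma>_init, v_init *\<^sub>R \<sigma>_init, \<pi>_init, v_init *\<^sub>R (w_init \<odot> \<pi>_init)) (\<sigma>, \<mu>, \<pi>, \<tau>)"
  shows "(\<sigma>, \<mu>) = Phi \<pi> \<tau> \<and> w_init = phi_inv_w \<sigma> \<and>
    phi_inv_w \<sigma> = sum_normalize (block_sums \<mu>)"
proof -
  have diff: "F differentiable (at x)" if "x \<in> simplex_prod" for x
    using real_analytic_on_imp_differentiable[OF assms(3)] assms(2) that by blast
  have w_sum: "(\<Sum>i\<in>UNIV. w_init $ i) = 1"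
    using assms(4) by (simp add: open_simplex_def)
  have \<pi>_sum: "\<pi>_init $ i \<bullet> 1 = 1" "1 \<bullet> \<pi>_init $ i = 1" for i
    using assms(5) by (simp_all add: simplex_prod_def unit_simplex_def inner_vec_def)
  have "reshape (v_init *\<^sub>R (w_init \<odot> \<pi>_init)) = v_init *\<^sub>R \<sigma>_init"
    by (rule block_eqI) (simp add: assms(8) odot_def)
  \<comment> \<open>So the scalar in the invariant starts as \<open>v_init\<close>, which is
    nonzero.\<close>
  moreover have "1 \<bullet> \<sigma>_init = 1"
    by (simp add: assms(8) inner_eq_sum_block \<pi>_sum w_sum)
  moreover have "row_sums (v_init *\<^sub>R (w_init \<odot> \<pi>_init)) = v_init *\<^sub>R w_init"
    by (simp add: row_sums_def odot_def vec_eq_iff \<pi>_sum)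
  ultimately have "coupled w_init
      (\<sigma>_init, v_init *\<^sub>R \<sigma>_init, \<pi>_init, v_init *\<^sub>R (w_init \<odot> \<pi>_init))"
    using assms(6,7,8) by (simp add: coupled_def \<pi>_sum)
  with assms(9) have "coupled w_init (\<sigma>, \<mu>, \<pi>, \<tau>)"
    by (induction rule: rtranclp_induct) (auto intro: coupled_joint_step[OF diff assms(4)])
  then have c: "\<sigma> = phi \<pi> w_init" "\<mu> = reshape \<tau>" "\<And>i. \<pi> $ i \<bullet> 1 = 1"
      "1 \<bullet> \<mu> \<noteq> 0" "row_sums \<tau> = (1 \<bullet> \<mu>) *\<^sub>R w_init"
    by (auto simp: coupled_def)
  \<comment> \<open>Normalization removes the nonzero scalar \<open>1 \<bullet> \<mu>\<close>,
    whatever its sign.\<close>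
  have "sum_normalize (row_sums \<tau>) = w_init"
    by (simp add: c(4,5) sum_normalize_scaleR w_sum)
  moreover have "block_sums \<mu> = row_sums \<tau>"
    by (simp add: block_sums_def row_sums_def c(2))
  moreover have "phi_inv_w \<sigma> = w_init"
    unfolding c(1) by (rule phi_inv_w_phi) (rule c(3))
  ultimately show ?thesis
    by (simp add: Phi_def c(1,2))
qed

end
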